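(* For every integer $n \ge 1$, real hyperbolic space $\mathbb{H}^n_{\mathbb{R}}$ of dimension $n$, equipped with its hyperbolic (geodesic) distance $d$, has strong negative type.
   Context: Let $(X,d)$ be a metric space. Negative type: $(X,d)$ has negative type if for all $m \ge 1$ and all lists of points $x_1,\dots,x_m$ and $x_1',\dots,x_m'$ in $X$ (repetitions allowed), $$2\sum_{i,j=1}^m d(x_i,x_j') \ \ge\ \sum_{i,j=1}^m \big(d(x_i,x_j)+d(x_i',x_j')\big).$$ Equivalently, for all $m\ge 1$, all $x_1,\dots,x_m\in X$ and all $\alpha_1,\dots,\alpha_m\in\mathbb{R}$ with $\sum_{i=1}^m\alpha_i=0$, one has $\sum_{i,j\le m}\alpha_i\alpha_j\, d(x_i,x_j)\le 0$. Finite first moment: a Borel probability measure $\mu$ on $X$ has finite first moment if $\int d(o,x)\,d\mu(x)<\infty$ for some (hence all) $o\in X$. Write $P_1(X,d)$ for the set of all Borel probability measures on $X$ with finite first moment. If $(X,d)$ has negative type, then for all $\mu_1,\mu_2\in P_1(X,d)$, $$\int d(x_1,x_2)\,d(\mu_1-\mu_2)^2(x_1,x_2)\ \le\ 0, \qquad ( * )$$ where $(\mu_1-\mu_2)^2$ denotes the product signed measure $(\mu_1-\mu_2)\times(\mu_1-\mu_2)$ on $X\times X$; that is, the left-hand side equals $\iint d(x,y)\,d\mu_1(x)\,d\mu_1(y)+\iint d(x,y)\,d\mu_2(x)\,d\mu_2(y)-2\iint d(x,y)\,d\mu_1(x)\,d\mu_2(y)$. Strong negative type: $(X,d)$ has strong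 negative type if it has negative type and, for $\mu_1,\mu_2\in P_1(X,d)$, equality holds in $( * )$ only when $\mu_1=\mu_2$. *)

theory Defs
  imports "HOL-Probability.Probability"
begin

section \<open>Negative type and strong negative type\<close>

text \<open>A metric space is a type of class \<^class>\<open>metric_space\<close>; its Borel sets are those of
  \<^const>\<open>borel\<close>.\<close>

definition negative_type :: "'a::metric_space itself \<Rightarrow> bool" where
  "negative_type _ \<longleftrightarrow>
    (\<forall>m\<ge>1. \<forall>x x' :: nat \<Rightarrow> 'a.
      2 * (\<Sum>i=1..m. \<Sum>j=1..m. dist (x i) (x' j)) \<ge>
      (\<Sum>i=1..m. \<Sum>j=1..m. dist (x i) (x j) + dist (x' i) (x' j)))"

definition finite_first_moment :: "'a::metric_space measure \<Rightarrow> bool" where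
  "finite_first_moment \<mu> \<longleftrightarrow> (\<exists>p. integrable \<mu> (\<lambda>x. dist p x))"

definition P1 :: "'a::metric_space measure set" where
  "P1 = {\<mu>. prob_space \<mu> \<and> sets \<mu> = sets borel \<and> finite_first_moment \<mu>}"

text \<open>The integral of the distance against the signed measure
  \<open>(\<mu>\<^sub>1 - \<mu>\<^sub>2) \<times> (\<mu>\<^sub>1 - \<mu>\<^sub>2)\<close>, expanded by bilinearity and symmetry. Iterated integrals
  are used because the distance need not be measurable for the product \<open>\<sigma>\<close>-algebra when the space
  is not separable, whereas the inner integrals are always Lipschitz in the outer variable.\<close>

definition dist_integral_diff :: "'a::metric_space measure \<Rightarrow> 'a measure \<Rightarrow> real" where
  "dist_integral_diff \<mu>\<^sub>1 \<mu>\<^sub>2 =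
    (\<integral>y. (\<integral>x. dist x y \<partial>\<mu>\<^sub>1) \<partial>\<mu>\<^sub>1) + (\<integral>y. (\<integral>x. dist x y \<partial>\<mu>\<^sub>2) \<partial>\<mu>\<^sub>2)
    - 2 * (\<integral>y. (\<integral>x. dist x y \<partial>\<mu>\<^sub>1) \<partial>\<mu>\<^sub>2)"

definition strong_negative_type :: "'a::metric_space itself \<Rightarrow> bool" where
  "strong_negative_type T \<longleftrightarrow> negative_type T \<and>
    (\<forall>\<mu>\<^sub>1\<in>P1. \<forall>\<mu>\<^sub>2\<in>(P1 :: 'a measure set). dist_integral_diff \<mu>\<^sub>1 \<mu>\<^sub>2 = 0 \<longrightarrow> \<mu>\<^sub>1 = \<mu>\<^sub>2)"


section \<open>Real hyperbolic space\<close>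

text \<open>The hyperboloid model: the upper sheet of \<open>\<langle>p, p\<rangle> = -1\<close> in \<open>\<real>\<^sup>n \<times> \<real>\<close> for the Lorentzian
  form \<open>\<langle>(x,s), (y,t)\<rangle> = x \<bullet> y - s t\<close>, with the distance given by
  \<open>cosh (d(p,q)) = - \<langle>p, q\<rangle>\<close>. The dimension \<open>n \<ge> 1\<close> is \<open>CARD('n)\<close>.\<close>

definition lorentz :: "(real^'n::finite) \<times> real \<Rightarrow> (real^'n) \<times> real \<Rightarrow> real" where
  "lorentz p q = fst p \<bullet> fst q - snd p * snd q"

typedef (overloaded) 'n hyperbolic_space =
  "{p :: (real^'n::finite) \<times> real. lorentz p p = -1 \<and> snd p > 0}"
  by (rule exI[of _ "(0,1)"]) (simp add: lorentz_def)

lemma lorentz_sym: "lorentz p q = lorentz q p"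
  by (simp add: lorentz_def inner_commute mult.commute)

lemma lorentz_diff_scaleR:
  "lorentz (p - a *\<^sub>R q) (r - b *\<^sub>R s) =
    lorentz p r - b * lorentz p s - a * lorentz q r + a * b * lorentz q s"
  by (simp add: lorentz_def inner_diff_left inner_diff_right algebra_simps)

lemma lorentz_orth_nonneg:
  assumes q: "lorentz q q = -1" "snd q > 0" and u: "lorentz u q = 0"
  shows "lorentz u u \<ge> 0"
proof -
  have t: "(snd q)\<^sup>2 = 1 + (norm (fst q))\<^sup>2"
    using q unfolding power2_norm_eq_inner by (simp add: lorentz_def power2_eq_square)
  have "(snd u)\<^sup>2 * (snd q)\<^sup>2 = (fst u \<bullet> fst q)\<^sup>2"
    using u by (simp add: lorentz_def flip: power_mult_distrib)
  also have "\<dots> \<le> (norm (fst u))\<^sup>2 * (norm (fst q))\<^sup>2"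
    unfolding power2_norm_eq_inner by (rule Cauchy_Schwarz_ineq)
  also have "\<dots> \<le> (norm (fst u))\<^sup>2 * (snd q)\<^sup>2"
    by (rule mult_left_mono) (auto simp: t)
  finally have "(snd u)\<^sup>2 \<le> (norm (fst u))\<^sup>2"
    using q(2) by simp
  then show ?thesis
    unfolding power2_norm_eq_inner by (simp add: lorentz_def power2_eq_square)
qed

lemma nonneg_quadratic_discriminant:
  fixes a b c :: real
  assumes nn: "\<And>l. 0 \<le> a - 2 * l * b + l\<^sup>2 * c" and "0 \<le> c"
  shows "b\<^sup>2 \<le> a * c"
proof (cases "c = 0")
  case True
  have "b = 0"
  proof (rule ccontr)
    assume "b \<noteq> 0"
    then have "a - 2 * ((a + 1) / (2 * b)) * b = -1" by (simp add: field_simps)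
    then show False
      using nn[of "(a + 1) / (2 * b)"] True by simp
  qed
  then show ?thesis by (simp add: True)
next
  case False
  have "0 \<le> (a - 2 * (b / c) * b + (b / c)\<^sup>2 * c) * c"
    by (rule mult_nonneg_nonneg[OF nn assms(2)])
  also have "\<dots> = a * c - b\<^sup>2"
    using False by (simp add: power2_eq_square algebra_simps)
  finally show ?thesis by simp
qed

lemma lorentz_orth_Cauchy_Schwarz:
  assumes q: "lorentz q q = -1" "snd q > 0" and u: "lorentz u q = 0" and v: "lorentz v q = 0"
  shows "(lorentz u v)\<^sup>2 \<le> lorentz u u * lorentz v v"
proof (rule nonneg_quadratic_discriminant)
  fix l
  have "lorentz (u - l *\<^sub>R v) q = 0"
    using lorentz_diff_scaleR[of u l v q 0 0] u v by simp
  then have "0 \<le> lorentz (u - l *\<^sub>R v) (u - l *\<^sub>R v)"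
    by (rule lorentz_orth_nonneg[OF q])
  also have "\<dots> = lorentz u u - 2 * l * lorentz u v + l\<^sup>2 * lorentz v v"
    unfolding lorentz_diff_scaleR lorentz_sym[of v u] by (simp add: power2_eq_square)
  finally show "0 \<le> lorentz u u - 2 * l * lorentz u v + l\<^sup>2 * lorentz v v" .
next
  show "0 \<le> lorentz v v" by (rule lorentz_orth_nonneg[OF q v])
qed

lemma lorentz_hyperboloid:
  assumes p: "lorentz p p = -1" "snd p > 0" and q: "lorentz q q = -1" "snd q > 0"
  shows "lorentz p q \<le> -1" and "lorentz p q = -1 \<longleftrightarrow> p = q"
proof -
  let ?a = "norm (fst p)" and ?b = "norm (fst q)"
  have tp: "(snd p)\<^sup>2 = 1 + ?a\<^sup>2" and tq: "(snd q)\<^sup>2 = 1 + ?b\<^sup>2"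
    using p q unfolding power2_norm_eq_inner by (simp_all add: lorentz_def power2_eq_square)
  have eq: "(snd p * snd q)\<^sup>2 = (1 + ?a * ?b)\<^sup>2 + (?a - ?b)\<^sup>2"
    unfolding power_mult_distrib tp tq by (simp add: power2_eq_square algebra_simps)
  have le: "1 + ?a * ?b \<le> snd p * snd q"
  proof (rule power2_le_imp_le)
    show "(1 + ?a * ?b)\<^sup>2 \<le> (snd p * snd q)\<^sup>2"
      unfolding eq by simp
    show "0 \<le> snd p * snd q"
      using p(2) q(2) by simp
  qed
  have cs: "fst p \<bullet> fst q \<le> ?a * ?b"
    by (rule norm_cauchy_schwarz)
  show "lorentz p q \<le> -1"
    using le cs unfolding lorentz_def by linarith
  show "lorentz p q = -1 \<longleftrightarrow> p = q"
  proof
    assume l: "lorentz p q = -1"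
    then have "snd p * snd q = 1 + ?a * ?b"
      using le cs unfolding lorentz_def by linarith
    then have "(?a - ?b)\<^sup>2 = 0"
      using eq by (simp only: add_cancel_left_right)
    then have "?a\<^sup>2 = ?b\<^sup>2" by simp
    then have "(snd p)\<^sup>2 = (snd q)\<^sup>2"
      unfolding tp tq by (rule arg_cong)
    then have s: "snd p = snd q"
      by (rule power2_eq_imp_eq) (use p(2) q(2) in simp_all)
    have "(fst p - fst q) \<bullet> (fst p - fst q) = 0"
      using l p(1) q(1) unfolding lorentz_def s inner_diff_left inner_diff_right
        inner_commute[of "fst q" "fst p"] by linarith
    then show "p = q"
      using s by (simp add: prod_eq_iff)
  next
    assume "p = q"
    then show "lorentz p q = -1"
      using p(1) by (simp only:)
  qed
qed

lemma arcosh_real_le_add: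
  fixes a b c :: real
  assumes "1 \<le> a" "1 \<le> b" "1 \<le> c" "(c - a * b)\<^sup>2 \<le> (a\<^sup>2 - 1) * (b\<^sup>2 - 1)"
  shows "arcosh c \<le> arcosh a + arcosh b"
proof -
  have "c - a * b \<le> sqrt (a\<^sup>2 - 1) * sqrt (b\<^sup>2 - 1)"
    using real_le_rsqrt[OF assms(4)] by (simp add: real_sqrt_mult)
  also have "sqrt (a\<^sup>2 - 1) * sqrt (b\<^sup>2 - 1) = sinh (arcosh a) * sinh (arcosh b)"
    using assms by (simp add: sinh_arcosh_real)
  finally have "cosh (arcosh c) \<le> cosh (arcosh a + arcosh b)"
    using assms by (simp add: cosh_add)
  moreover have "0 \<le> arcosh c" "0 \<le> arcosh a + arcosh b"
    using assms by (simp_all add: add_nonneg_nonneg)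
  ultimately show ?thesis
    by (simp only: cosh_real_nonneg_le_iff)
qed

instantiation hyperbolic_space :: (finite) metric_space
begin

definition dist_hyperbolic_space :: "'a hyperbolic_space \<Rightarrow> 'a hyperbolic_space \<Rightarrow> real" where
  "dist_hyperbolic_space p q = arcosh (- lorentz (Rep_hyperbolic_space p) (Rep_hyperbolic_space q))"

definition uniformity_hyperbolic_space :: "('a hyperbolic_space \<times> 'a hyperbolic_space) filter" where
  "uniformity_hyperbolic_space = (INF e\<in>{0<..}. principal {(p, q). dist p q < e})"

definition open_hyperbolic_space :: "'a hyperbolic_space set \<Rightarrow> bool" where
  "open_hyperbolic_space U \<longleftrightarrow> (\<forall>p\<in>U. \<forall>\<^sub>F (p', q) in uniformity. p' = p \<longrightarrow> q \<in> U)"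

instance
proof
  fix p q r :: "'a hyperbolic_space"
  let ?p = "Rep_hyperbolic_space p" and ?q = "Rep_hyperbolic_space q"
    and ?r = "Rep_hyperbolic_space r"
  have p: "lorentz ?p ?p = -1" "snd ?p > 0" and q: "lorentz ?q ?q = -1" "snd ?q > 0"
    and r: "lorentz ?r ?r = -1" "snd ?r > 0"
    using Rep_hyperbolic_space[of p] Rep_hyperbolic_space[of q] Rep_hyperbolic_space[of r] by auto
  note pq = lorentz_hyperboloid[OF p q] and pr = lorentz_hyperboloid[OF p r]
    and qr = lorentz_hyperboloid[OF q r]
  have "arcosh (- lorentz ?p ?q) = 0 \<longleftrightarrow> - lorentz ?p ?q = 1"
    using pq(1) by (intro arcosh_eq_0_iff_real) simp
  then show "dist p q = 0 \<longleftrightarrow> p = q"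
    using pq(2) by (auto simp: dist_hyperbolic_space_def Rep_hyperbolic_space_inject)
  show "dist p q \<le> dist p r + dist q r"
    unfolding dist_hyperbolic_space_def
  proof (rule arcosh_real_le_add)
    define A where "A = - lorentz ?p ?r"
    define B where "B = - lorentz ?q ?r"
    have AB: "lorentz ?p ?r = - A" "lorentz ?r ?p = - A" "lorentz ?q ?r = - B" "lorentz ?r ?q = - B"
      using lorentz_sym[of ?r ?p] lorentz_sym[of ?r ?q] by (simp_all add: A_def B_def)
    have u: "lorentz (?p - A *\<^sub>R ?r) ?r = 0" and v: "lorentz (?q - B *\<^sub>R ?r) ?r = 0"
      using lorentz_diff_scaleR[of ?p A ?r ?r 0 0] lorentz_diff_scaleR[of ?q B ?r ?r 0 0] r(1)
      by (simp_all add: AB)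
    have "lorentz (?p - A *\<^sub>R ?r) (?q - B *\<^sub>R ?r) = - (- lorentz ?p ?q - A * B)"
      and "lorentz (?p - A *\<^sub>R ?r) (?p - A *\<^sub>R ?r) = A\<^sup>2 - 1"
      and "lorentz (?q - B *\<^sub>R ?r) (?q - B *\<^sub>R ?r) = B\<^sup>2 - 1"
      using p(1) q(1) r(1)
      by (simp_all add: lorentz_diff_scaleR AB power2_eq_square algebra_simps)
    with lorentz_orth_Cauchy_Schwarz[OF r u v]
    show "(- lorentz ?p ?q - - lorentz ?p ?r * - lorentz ?q ?r)\<^sup>2 \<le>
        ((- lorentz ?p ?r)\<^sup>2 - 1) * ((- lorentz ?q ?r)\<^sup>2 - 1)"
      by (simp only: A_def B_def power2_minus)
  qed (use pq(1) pr(1) qr(1) in simp_all)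
qed (simp_all only: uniformity_hyperbolic_space_def open_hyperbolic_space_def)

end

end

theory Submission
  imports Defs
begin

text \<open>The proof writes the hyperbolic distance explicitly as a squared distance in \<open>\<ell>\<^sup>2\<close>. Let
  \<open>X\<close> and \<open>Y\<close> be the points of the open unit ball that represent \<open>p\<close> and \<open>q\<close> in the Klein model, let
  \<open>r\<close> and \<open>s\<close> be the last coordinates of \<open>p\<close> and \<open>q\<close> in the hyperboloid model, and let
  \<open>w = X \<bullet> Y\<close>. Then \<open>u = cosh (dist p q)\<close> is \<open>r s (1 - w)\<close>, and
  \<open>arcosh u = ln (2 u) - \<Sum>k\<ge>1. b\<^sub>k u\<^sup>-\<^sup>2\<^sup>k\<close> with coefficients \<open>b\<^sub>k \<ge> 0\<close>, so

    \<open>dist p q = ln 2 + ln r + ln s - K p q\<close>, where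
    \<open>K p q = - ln (1 - w) + (\<Sum>k\<ge>1. b\<^sub>k (r s)\<^sup>-\<^sup>2\<^sup>k (1 - w)\<^sup>-\<^sup>2\<^sup>k)\<close>.

  The functions \<open>- ln (1 - w)\<close> and \<open>(1 - w)\<^sup>-\<^sup>2\<^sup>k\<close> are power series in \<open>w\<close> with nonnegative coefficients,
  and \<open>w\<^sup>j\<close> is the sum of the products \<open>X\<^sup>l Y\<^sup>l\<close> over all words \<open>l\<close> of length \<open>j\<close> in the coordinate
  indices. Therefore \<open>K p q = \<Sum>t. f\<^sub>t p * f\<^sub>t q\<close> for countably many functions \<open>f\<^sub>t\<close>, the features
  (\<open>has_sum_feature_kernel\<close>), and since the distance vanishes on the diagonal,
  \<open>2 dist p q = \<Sum>t. (f\<^sub>t p - f\<^sub>t q)\<^sup>2\<close> (\<open>has_sum_feature_dist\<close>).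

  Such a representation yields negative type at once. Integrated against a difference of measures
  it gives \<open>dist_integral_diff \<mu> \<nu> = - (\<Sum>t. (\<integral>f\<^sub>t d\<mu> - \<integral>f\<^sub>t d\<nu>)\<^sup>2)\<close>, see
  \<open>has_sum_dist_integral_diff\<close>. If this vanishes, all features have equal means. The features coming
  from \<open>- ln (1 - w)\<close> are multiples of all nonconstant monomials in the Klein coordinates, so \<open>\<mu>\<close> and
  \<open>\<nu>\<close> have the same moments in a compact ball and agree by the Stone-Weierstrass theorem
  (\<open>measure_eqI_moments\<close>, \<open>P1_eq_if_feature_means_eq\<close>).\<close>

section \<open>Distances that are sums of squares\<close>

lemma nn_integral_count_space_has_sum:
  fixes f :: "'t \<Rightarrow> real"
  assumes "(f has_sum s) T" and nonneg: "\<And>t. t \<in> T \<Longrightarrow> 0 \<le> f t"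
  shows "(\<integral>\<^sup>+t. ennreal (f t) \<partial>count_space T) = ennreal s"
proof -
  have "Infinite_Set_Sum.abs_summable_on f T"
    using assms(1) by (metis abs_summable_equivalent summable_on_def summable_on_iff_abs_summable_on_real)
  moreover from this have "infsetsum f T = s"
    using assms(1) by (metis abs_summable_equivalent infsetsum_infsum infsumI)
  ultimately show ?thesis
    using nn_integral_conv_infsetsum[of f T] nonneg by simp
qed

lemma has_sum_if_nn_integral_count_space:
  fixes f :: "'t \<Rightarrow> real"
  assumes "(\<integral>\<^sup>+t. ennreal (f t) \<partial>count_space T) = ennreal s" "0 \<le> s"
    and nonneg: "\<And>t. t \<in> T \<Longrightarrow> 0 \<le> f t"
  shows "(f has_sum s) T"
proof -
  have "Infinite_Set_Sum.abs_summable_on f T"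
    unfolding abs_summable_on_def using assms
    by (intro integrableI_nonneg) (auto simp: AE_count_space)
  moreover from this have "infsetsum f T = s"
    using nn_integral_conv_infsetsum[of f T] assms by (simp add: infsetsum_nonneg)
  ultimately show ?thesis
    by (metis abs_summable_equivalent has_sum_infsum infsetsum_infsum summable_on_iff_abs_summable_on_real)
qed

text \<open>Tonelli for a countable sum. It is stated for real-valued functions whose sum is known to be
  integrable, so that later identities between sums of integrals can be added and subtracted.\<close>

lemma has_sum_integral:
  fixes f :: "'t \<Rightarrow> 'a \<Rightarrow> real"
  assumes T: "countable T"
    and f: "\<And>t. t \<in> T \<Longrightarrow> integrable M (f t)" and g: "integrable M g"
    and nonneg: "\<And>t x. t \<in> T \<Longrightarrow> 0 \<le> f t x"
    and sum: "\<And>x. ((\<lambda>t. f t x) has_sum g x) T"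
  shows "((\<lambda>t. \<integral>x. f t x \<partial>M) has_sum (\<integral>x. g x \<partial>M)) T"
proof (rule has_sum_if_nn_integral_count_space)
  have g0: "0 \<le> g x" for x
    using has_sum_nonneg[OF sum] nonneg by blast
  then show "0 \<le> (\<integral>x. g x \<partial>M)"
    by simp
  show "0 \<le> (\<integral>x. f t x \<partial>M)" if "t \<in> T" for t
    using nonneg[OF that] by simp
  have "(\<integral>\<^sup>+t. ennreal (\<integral>x. f t x \<partial>M) \<partial>count_space T)
      = (\<integral>\<^sup>+t. \<integral>\<^sup>+x. ennreal (f t x) \<partial>M \<partial>count_space T)"
    by (intro nn_integral_cong nn_integral_eq_integral[symmetric] f) (auto simp: nonneg)
  also have "\<dots> = (\<integral>\<^sup>+x. \<integral>\<^sup>+t. ennreal (f t x) \<partial>count_space T \<partial>M)"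
    using f by (intro nn_integral_count_space_nn_integral[symmetric] T) auto
  also have "\<dots> = (\<integral>\<^sup>+x. ennreal (g x) \<partial>M)"
    by (intro nn_integral_cong nn_integral_count_space_has_sum sum nonneg)
  also have "\<dots> = ennreal (\<integral>x. g x \<partial>M)"
    by (intro nn_integral_eq_integral g) (auto simp: g0)
  finally show "(\<integral>\<^sup>+t. ennreal (\<integral>x. f t x \<partial>M) \<partial>count_space T) = ennreal (\<integral>x. g x \<partial>M)" .
qed

lemma integrable_dist_P1:
  assumes "\<mu> \<in> P1"
  shows "integrable \<mu> (\<lambda>x. dist x y)"
proof -
  obtain p where p: "integrable \<mu> (\<lambda>x. dist p x)" and sets: "sets \<mu> = sets borel" and "prob_space \<mu>"
    using assms by (auto simp: P1_def finite_first_moment_def)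
  then interpret prob_space \<mu> by simp
  show ?thesis
  proof (rule Bochner_Integration.integrable_bound)
    show "integrable \<mu> (\<lambda>x. dist p x + dist p y)"
      using p by simp
    have "(\<lambda>x. dist x y) \<in> borel_measurable borel"
      by (intro borel_measurable_continuous_onI continuous_intros)
    then show "(\<lambda>x. dist x y) \<in> borel_measurable \<mu>"
      by (simp add: measurable_cong_sets[OF sets refl])
    show "AE x in \<mu>. norm (dist x y) \<le> norm (dist p x + dist p y)"
      by (simp add: dist_triangle3)
  qed
qed

text \<open>The mean distance to \<open>\<mu>\<close> is 1-Lipschitz, which settles measurability without any
  separability assumption and bounds it by an affine function of the distance to one point.\<close>

lemma integrable_integral_dist_P1:
  assumes "\<mu> \<in> P1" "\<nu> \<in> P1"
  shows "integrable \<nu> (\<lambda>y. \<integral>x. dist x y \<partial>\<mu>)"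
proof -
  have sets: "sets \<nu> = sets borel" and "prob_space \<mu>" "prob_space \<nu>"
    using assms by (auto simp: P1_def)
  then interpret \<mu>: prob_space \<mu> + \<nu>: prob_space \<nu> by simp_all
  note int = integrable_dist_P1[OF assms(1)]
  have le: "(\<integral>x. dist x y \<partial>\<mu>) \<le> (\<integral>x. dist x z \<partial>\<mu>) + dist z y" for y z
  proof -
    have "(\<integral>x. dist x y \<partial>\<mu>) \<le> (\<integral>x. dist x z + dist z y \<partial>\<mu>)"
      by (intro integral_mono int Bochner_Integration.integrable_add) (auto simp: dist_triangle)
    then show ?thesis
      using int by (simp add: \<mu>.prob_space)
  qed
  have "\<bar>(\<integral>x. dist x y \<partial>\<mu>) - (\<integral>x. dist x z \<partial>\<mu>)\<bar> \<le> dist y z" for y z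
    using le[of y z] le[of z y] by (simp add: dist_commute abs_le_iff)
  then have "1-lipschitz_on UNIV (\<lambda>y. \<integral>x. dist x y \<partial>\<mu>)"
    by (intro lipschitz_onI) (auto simp: dist_real_def)
  then have "(\<lambda>y. \<integral>x. dist x y \<partial>\<mu>) \<in> borel_measurable borel"
    by (intro borel_measurable_continuous_onI lipschitz_on_continuous_on)
  then have meas: "(\<lambda>y. \<integral>x. dist x y \<partial>\<mu>) \<in> borel_measurable \<nu>"
    by (simp add: measurable_cong_sets[OF sets refl])
  show ?thesis
  proof (rule Bochner_Integration.integrable_bound[OF _ meas])
    fix o' :: 'a
    show "integrable \<nu> (\<lambda>y. (\<integral>x. dist x o' \<partial>\<mu>) + dist y o')"
      using integrable_dist_P1[OF assms(2)] by simp
    show "AE y in \<nu>. norm (\<integral>x. dist x y \<partial>\<mu>) \<le> norm ((\<integral>x. dist x o' \<partial>\<mu>) + dist y o')"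
      using le[of _ o'] by (simp add: dist_commute)
  qed
qed

lemma has_sum_minus:
  fixes f g :: "'t \<Rightarrow> real"
  assumes "(f has_sum a) T" "(g has_sum b) T"
  shows "((\<lambda>t. f t - g t) has_sum a - b) T"
  using has_sum_add[OF assms(1) has_sum_cmult_right[OF assms(2), of "- 1"]] by simp

lemma has_sum_finite_sum:
  fixes f :: "'i \<Rightarrow> 't \<Rightarrow> 'b::topological_comm_monoid_add"
  assumes "\<And>i. i \<in> I \<Longrightarrow> (f i has_sum s i) T"
  shows "((\<lambda>t. \<Sum>i\<in>I. f i t) has_sum (\<Sum>i\<in>I. s i)) T"
  using assms by (induction I rule: infinite_finite_induct) (auto intro: has_sum_add)

text \<open>The diagonal parts \<open>\<Sum>a\<^sup>2\<close> and \<open>\<Sum>b\<^sup>2\<close> cancel in the combination occurring in negative type,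
  leaving only the squared difference of the two sums.\<close>

lemma sum_square_differences:
  fixes a b :: "'i \<Rightarrow> real"
  shows "(\<Sum>i\<in>I. \<Sum>j\<in>I. (a i - b j)\<^sup>2) =
    real (card I) * (\<Sum>i\<in>I. (a i)\<^sup>2) + real (card I) * (\<Sum>j\<in>I. (b j)\<^sup>2)
    - 2 * ((\<Sum>i\<in>I. a i) * (\<Sum>j\<in>I. b j))"
proof -
  have "(a i - b j)\<^sup>2 = (a i)\<^sup>2 + (b j)\<^sup>2 - 2 * (a i * b j)" for i j
    by (simp add: power2_diff)
  then show ?thesis
    by (simp add: sum.distrib sum_subtractf flip: sum_distrib_left sum_distrib_right)
qed

lemma negative_type_if_sum_of_squares:
  fixes f :: "'t \<Rightarrow> 'a::metric_space \<Rightarrow> real"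
  assumes c: "0 < c" and sum: "\<And>x y. ((\<lambda>t. (f t x - f t y)\<^sup>2) has_sum c * dist x y) T"
  shows "negative_type TYPE('a)"
  unfolding negative_type_def
proof (intro allI impI)
  fix m :: nat and x x' :: "nat \<Rightarrow> 'a"
  let ?L = "\<Sum>i=1..m. \<Sum>j=1..m. dist (x i) (x' j)"
  let ?R = "\<Sum>i=1..m. \<Sum>j=1..m. dist (x i) (x j) + dist (x' i) (x' j)"
  let ?l = "\<lambda>t. \<Sum>i=1..m. \<Sum>j=1..m. (f t (x i) - f t (x' j))\<^sup>2"
  let ?r = "\<lambda>t. \<Sum>i=1..m. \<Sum>j=1..m. (f t (x i) - f t (x j))\<^sup>2 + (f t (x' i) - f t (x' j))\<^sup>2"
  have l: "(?l has_sum (\<Sum>i=1..m. \<Sum>j=1..m. c * dist (x i) (x' j))) T"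
    by (intro has_sum_finite_sum sum)
  have r: "(?r has_sum (\<Sum>i=1..m. \<Sum>j=1..m. c * dist (x i) (x j) + c * dist (x' i) (x' j))) T"
    by (intro has_sum_finite_sum has_sum_add sum)
  have diff: "((\<lambda>t. 2 * ?l t - ?r t) has_sum
      2 * (\<Sum>i=1..m. \<Sum>j=1..m. c * dist (x i) (x' j))
      - (\<Sum>i=1..m. \<Sum>j=1..m. c * dist (x i) (x j) + c * dist (x' i) (x' j))) T"
    by (intro has_sum_minus has_sum_cmult_right l r)
  have square: "2 * ?l t - ?r t = 2 * ((\<Sum>i=1..m. f t (x i)) - (\<Sum>i=1..m. f t (x' i)))\<^sup>2" for t
    unfolding sum.distrib sum_square_differences by (simp add: power2_eq_square algebra_simps)
  have "0 \<le> 2 * (\<Sum>i=1..m. \<Sum>j=1..m. c * dist (x i) (x' j))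
      - (\<Sum>i=1..m. \<Sum>j=1..m. c * dist (x i) (x j) + c * dist (x' i) (x' j))"
    by (rule has_sum_nonneg[OF diff]) (unfold square, simp)
  also have "\<dots> = c * (2 * ?L - ?R)"
    by (simp add: right_diff_distrib sum_distrib_left distrib_left mult.left_commute)
  finally show "?R \<le> 2 * ?L"
    using c by (simp add: zero_le_mult_iff)
qed

text \<open>A single summand is bounded by the whole sum, so \<open>(f t x - f t y)\<^sup>2 \<le> c * dist x y\<close>. Hence each
  \<open>f t\<close> is continuous and its square grows at most linearly in the distance: measurability and
  square integrability against measures in \<^const>\<open>P1\<close> come for free.\<close>

lemma integrable_feature:
  fixes f :: "'t \<Rightarrow> 'a::metric_space \<Rightarrow> real"
  assumes c: "0 < c" and sum: "\<And>x y. ((\<lambda>t. (f t x - f t y)\<^sup>2) has_sum c * dist x y) T"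
    and t: "t \<in> T" and \<mu>: "\<mu> \<in> P1"
  shows "integrable \<mu> (f t)" and "integrable \<mu> (\<lambda>x. (f t x)\<^sup>2)"
proof -
  have sets: "sets \<mu> = sets borel" and "prob_space \<mu>"
    using \<mu> by (auto simp: P1_def)
  then interpret prob_space \<mu> by simp
  have le: "(f t x - f t y)\<^sup>2 \<le> c * dist x y" for x y
    using has_sum_mono2[OF has_sum_finite[of "{t}"] sum[of x y]] t by simp
  have "isCont (f t) x" for x
    unfolding isCont_def
  proof (rule Lim_null_comparison[THEN Lim_null[THEN iffD2]])
    show "\<forall>\<^sub>F y in at x. norm (f t y - f t x) \<le> sqrt (c * dist y x)"
      using real_le_rsqrt[of "\<bar>f t _ - f t _\<bar>"] le by (simp add: always_eventually)
    have "((\<lambda>y. sqrt (c * dist y x)) \<longlongrightarrow> sqrt (c * dist x x)) (at x)"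
      by (intro tendsto_intros)
    then show "((\<lambda>y. sqrt (c * dist y x)) \<longlongrightarrow> 0) (at x)"
      by simp
  qed
  then have "f t \<in> borel_measurable borel"
    by (intro borel_measurable_continuous_onI continuous_at_imp_continuous_on) auto
  then have [measurable]: "f t \<in> borel_measurable \<mu>"
    by (simp add: measurable_cong_sets[OF sets refl])
  fix z :: 'a
  show *: "integrable \<mu> (\<lambda>x. (f t x)\<^sup>2)"
  proof (rule Bochner_Integration.integrable_bound)
    show "integrable \<mu> (\<lambda>x. 2 * (f t z)\<^sup>2 + 2 * (c * dist x z))"
      using integrable_dist_P1[OF \<mu>] by simp
    \<comment> \<open>With \<open>a = f t x\<close> and \<open>b = f t z\<close>: \<open>2 b\<^sup>2 + 2 (a - b)\<^sup>2 - a\<^sup>2 = (a - 2 b)\<^sup>2\<close>.\<close>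
    have "(f t x)\<^sup>2 \<le> 2 * (f t z)\<^sup>2 + 2 * (c * dist x z)" for x
      using le[of x z] zero_le_power2[of "f t x - 2 * f t z"]
      by (simp add: power2_eq_square algebra_simps)
    then show "AE x in \<mu>. norm ((f t x)\<^sup>2) \<le> norm (2 * (f t z)\<^sup>2 + 2 * (c * dist x z))"
      using c by simp
  qed measurable
  show "integrable \<mu> (f t)"
    by (rule square_integrable_imp_integrable[OF _ *]) simp
qed

text \<open>Integrating \<open>(f t x - f t y)\<^sup>2\<close> against \<open>(\<mu> - \<nu>) \<times> (\<mu> - \<nu>)\<close> kills the terms depending on one
  variable only, since \<open>\<mu> - \<nu>\<close> has total mass \<open>0\<close>; the mixed term gives minus twice the square of
  \<open>\<integral>f t d(\<mu> - \<nu>)\<close>. To keep all sums nonnegative, the three double integrals are expanded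
  separately (\<open>pair\<close>) and combined afterwards.\<close>

lemma has_sum_dist_integral_diff:
  fixes f :: "'t \<Rightarrow> 'a::metric_space \<Rightarrow> real"
  assumes T: "countable T" and c: "0 < c"
    and sum: "\<And>x y. ((\<lambda>t. (f t x - f t y)\<^sup>2) has_sum c * dist x y) T"
    and \<mu>: "\<mu> \<in> P1" and \<nu>: "\<nu> \<in> P1"
  shows "((\<lambda>t. 2 * ((\<integral>x. f t x \<partial>\<mu>) - (\<integral>x. f t x \<partial>\<nu>))\<^sup>2) has_sum
    - c * dist_integral_diff \<mu> \<nu>) T"
proof -
  note int = integrable_feature[OF c sum]
  have pair: "((\<lambda>t. (\<integral>x. (f t x)\<^sup>2 \<partial>\<mu>) - 2 * (\<integral>x. f t x \<partial>\<mu>) * (\<integral>y. f t y \<partial>\<nu>) + (\<integral>y. (f t y)\<^sup>2 \<partial>\<nu>))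
      has_sum c * (\<integral>y. \<integral>x. dist x y \<partial>\<mu> \<partial>\<nu>)) T"
    if \<mu>: "\<mu> \<in> P1" and \<nu>: "\<nu> \<in> P1" for \<mu> \<nu> :: "'a measure"
  proof -
    interpret \<mu>: prob_space \<mu> using \<mu> by (simp add: P1_def)
    interpret \<nu>: prob_space \<nu> using \<nu> by (simp add: P1_def)
    have sq: "(\<lambda>x. (f t x - f t y)\<^sup>2) = (\<lambda>x. (f t x)\<^sup>2 - 2 * f t y * f t x + (f t y)\<^sup>2)" for t y
      by (simp add: power2_eq_square algebra_simps)
    have i1: "integrable \<mu> (\<lambda>x. (f t x - f t y)\<^sup>2)" if "t \<in> T" for t y
      unfolding sq using int[OF that \<mu>] by simp
    have e1: "(\<integral>x. (f t x - f t y)\<^sup>2 \<partial>\<mu>)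
        = (\<integral>x. (f t x)\<^sup>2 \<partial>\<mu>) - 2 * (\<integral>x. f t x \<partial>\<mu>) * f t y + (f t y)\<^sup>2" if "t \<in> T" for t y
      unfolding sq using int[OF that \<mu>] by (simp add: \<mu>.prob_space)
    have inner: "((\<lambda>t. \<integral>x. (f t x - f t y)\<^sup>2 \<partial>\<mu>) has_sum (\<integral>x. c * dist x y \<partial>\<mu>)) T" for y
      by (rule has_sum_integral[OF T i1 _ _ sum]) (use integrable_dist_P1[OF \<mu>] in simp_all)
    have i2: "integrable \<nu> (\<lambda>y. \<integral>x. (f t x - f t y)\<^sup>2 \<partial>\<mu>)" if "t \<in> T" for t
      unfolding e1[OF that] using int[OF that \<nu>] by simp
    have "((\<lambda>t. \<integral>y. \<integral>x. (f t x - f t y)\<^sup>2 \<partial>\<mu> \<partial>\<nu>) has_sum (\<integral>y. \<integral>x. c * dist x y \<partial>\<mu> \<partial>\<nu>)) T"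
      by (rule has_sum_integral[OF T i2 _ _ inner])
        (use integrable_integral_dist_P1[OF \<mu> \<nu>] in simp_all)
    also have "(\<integral>y. \<integral>x. c * dist x y \<partial>\<mu> \<partial>\<nu>) = c * (\<integral>y. \<integral>x. dist x y \<partial>\<mu> \<partial>\<nu>)"
      by simp
    finally show ?thesis
    proof (rule has_sum_cong[THEN iffD1, rotated])
      fix t assume "t \<in> T"
      then show "(\<integral>y. \<integral>x. (f t x - f t y)\<^sup>2 \<partial>\<mu> \<partial>\<nu>) =
          (\<integral>x. (f t x)\<^sup>2 \<partial>\<mu>) - 2 * (\<integral>x. f t x \<partial>\<mu>) * (\<integral>y. f t y \<partial>\<nu>) + (\<integral>y. (f t y)\<^sup>2 \<partial>\<nu>)"
        using int[of t \<nu>] \<nu> by (simp add: e1 \<nu>.prob_space)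
    qed
  qed
  have "((\<lambda>t. 2 * ((\<integral>x. (f t x)\<^sup>2 \<partial>\<mu>) - 2 * (\<integral>x. f t x \<partial>\<mu>) * (\<integral>y. f t y \<partial>\<nu>) + (\<integral>y. (f t y)\<^sup>2 \<partial>\<nu>))
      - (((\<integral>x. (f t x)\<^sup>2 \<partial>\<mu>) - 2 * (\<integral>x. f t x \<partial>\<mu>) * (\<integral>y. f t y \<partial>\<mu>) + (\<integral>y. (f t y)\<^sup>2 \<partial>\<mu>))
       + ((\<integral>x. (f t x)\<^sup>2 \<partial>\<nu>) - 2 * (\<integral>x. f t x \<partial>\<nu>) * (\<integral>y. f t y \<partial>\<nu>) + (\<integral>y. (f t y)\<^sup>2 \<partial>\<nu>))))
      has_sum 2 * (c * (\<integral>y. \<integral>x. dist x y \<partial>\<mu> \<partial>\<nu>))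
        - (c * (\<integral>y. \<integral>x. dist x y \<partial>\<mu> \<partial>\<mu>) + c * (\<integral>y. \<integral>x. dist x y \<partial>\<nu> \<partial>\<nu>))) T"
    by (intro has_sum_minus has_sum_add has_sum_cmult_right pair \<mu> \<nu>)
  then show ?thesis
    by (simp add: dist_integral_diff_def power2_eq_square algebra_simps)
qed

text \<open>The criterion used for hyperbolic space. The hypothesis says that \<open>x \<mapsto> (f t x)\<^sub>t\<close> maps the space,
  up to the constant \<open>c\<close> and a choice of origin, isometrically for the square root of the distance
  into \<open>\<ell>\<^sup>2(T)\<close>; equality in the negative type inequality then forces the two measures to have the
  same barycenter there.\<close>

theorem strong_negative_type_if_sum_of_squares:
  fixes f :: "'t \<Rightarrow> 'a::metric_space \<Rightarrow> real"
  assumes T: "countable T" and c: "0 < c"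
    and sum: "\<And>x y. ((\<lambda>t. (f t x - f t y)\<^sup>2) has_sum c * dist x y) T"
    and separating: "\<And>\<mu> \<nu>. \<mu> \<in> P1 \<Longrightarrow> \<nu> \<in> P1 \<Longrightarrow>
      (\<And>t. t \<in> T \<Longrightarrow> (\<integral>x. f t x \<partial>\<mu>) = (\<integral>x. f t x \<partial>\<nu>)) \<Longrightarrow> \<mu> = \<nu>"
  shows "strong_negative_type TYPE('a)"
  unfolding strong_negative_type_def
proof (intro conjI ballI impI)
  show "negative_type TYPE('a)"
    by (rule negative_type_if_sum_of_squares[OF c sum])
  fix \<mu> \<nu> :: "'a measure"
  assume \<mu>: "\<mu> \<in> P1" and \<nu>: "\<nu> \<in> P1" and "dist_integral_diff \<mu> \<nu> = 0"
  then have "((\<lambda>t. 2 * ((\<integral>x. f t x \<partial>\<mu>) - (\<integral>x. f t x \<partial>\<nu>))\<^sup>2) has_sum 0) T"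
    using has_sum_dist_integral_diff[OF T c sum \<mu> \<nu>] by simp
  from nonneg_has_sum_le_0D[OF this] show "\<mu> = \<nu>"
    by (intro separating[OF \<mu> \<nu>]) simp
qed

section \<open>Power series of the inverse hyperbolic cosine\<close>

lemma negative_binomial_sums:
  fixes a w :: real
  assumes "\<bar>w\<bar> < 1"
  shows "(\<lambda>j. pochhammer a j / fact j * w ^ j) sums (1 - w) powr - a"
proof -
  have "(- 1) ^ j * (- w) ^ j = w ^ j" for j
    by (simp flip: power_mult_distrib)
  then have "(- a gchoose j) * (- w) ^ j = pochhammer a j / fact j * w ^ j" for j
    by (simp add: gbinomial_pochhammer mult.commute mult.left_commute)
  then show ?thesis
    using gen_binomial_real[of "- w" "- a"] assms by simp
qed

text \<open>The coefficients in \<open>arcosh u = ln (2 u) - \<Sum>k\<ge>1. arcosh_coeff k / u\<^sup>2\<^sup>k\<close>, that is,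
  \<open>binomial(2k, k) / (4\<^sup>k 2k)\<close>. Division by zero gives the value \<open>0\<close> at \<open>k = 0\<close>.\<close>

definition arcosh_coeff :: "nat \<Rightarrow> real" where
  "arcosh_coeff k = pochhammer (1 / 2) k / fact k / (2 * real k)"

lemma arcosh_coeff_nonneg: "0 \<le> arcosh_coeff k"
  by (simp add: arcosh_coeff_def pochhammer_nonneg)

lemma arcosh_coeff_0 [simp]: "arcosh_coeff 0 = 0"
  by (simp add: arcosh_coeff_def)

text \<open>Both sides vanish at \<open>0\<close>, and for \<open>0 < x < 1\<close> both have the derivative
  \<open>(1 / sqrt (1 - x) - 1) / (2 x)\<close>, on the left by the binomial series for \<open>1 / sqrt (1 - x)\<close>.\<close>

lemma arcosh_coeff_sums_lt:
  assumes "0 \<le> z" "z < 1"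
  shows "(\<lambda>k. arcosh_coeff k * z ^ k) sums (ln 2 - ln (1 + sqrt (1 - z)))"
proof -
  let ?b = "\<lambda>k. pochhammer (1 / 2) k / fact k :: real"
  let ?F = "\<lambda>z. \<Sum>k. arcosh_coeff k * z ^ k"
  let ?G = "\<lambda>z :: real. ln 2 - ln (1 + sqrt (1 - z))"
  have smb: "summable (\<lambda>k. arcosh_coeff k * x ^ k)" if "norm x < 1" for x
  proof (rule summable_comparison_test')
    show "summable (\<lambda>k. ?b k * \<bar>x\<bar> ^ k)"
      using negative_binomial_sums[of "\<bar>x\<bar>" "1/2"] that by (auto simp: sums_iff)
    have "arcosh_coeff k \<le> ?b k" for k
      using pochhammer_nonneg[of "1 / 2 :: real" k] unfolding arcosh_coeff_def
      by (cases "k = 0") (auto simp: divide_le_eq mult_le_cancel_left1)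
    then have "arcosh_coeff k * \<bar>x\<bar> ^ k \<le> ?b k * \<bar>x\<bar> ^ k" for k
      by (rule mult_right_mono) simp
    then show "norm (arcosh_coeff k * x ^ k) \<le> ?b k * \<bar>x\<bar> ^ k" for k
      by (simp add: abs_mult power_abs arcosh_coeff_nonneg)
  qed
  have dF: "(?F has_real_derivative (\<Sum>k. diffs arcosh_coeff k * x ^ k)) (at x)" if "norm x < 1" for x
    by (rule termdiffs_strong'[OF smb that])
  have "?F z - ?G z = ?F 0 - ?G 0" if "0 < z"
  proof (rule DERIV_isconst2[OF that])
    show "continuous_on {0..z} (\<lambda>z. ?F z - ?G z)"
    proof (intro continuous_intros)
      show "continuous_on {0..z} ?F"
        using assms by (intro DERIV_continuous_on[OF has_field_derivative_at_within[OF dF]]) auto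
      show "\<forall>x\<in>{0..z}. 1 + sqrt (1 - x) \<noteq> 0"
      proof
        fix x assume "x \<in> {0..z}"
        then have "0 \<le> sqrt (1 - x)" using assms by simp
        then show "1 + sqrt (1 - x) \<noteq> 0" by linarith
      qed
    qed
    fix x assume x: "0 < x" "x < z"
    let ?s = "sqrt (1 - x)"
    have s: "0 < ?s" "x = (1 - ?s) * (1 + ?s)"
      using x assms by (auto simp: algebra_simps)
    have dG: "(?G has_real_derivative 1 / (2 * ?s * (1 + ?s))) (at x)"
      using s(1) x assms
      by (auto intro!: derivative_eq_intros simp: add_pos_pos) (simp add: field_simps)
    have "diffs arcosh_coeff k = ?b (Suc k) / 2" for k
      by (simp add: diffs_def arcosh_coeff_def del: fact_Suc of_nat_Suc)
    then have "diffs arcosh_coeff k * x ^ k = ?b (Suc k) * x ^ Suc k / (2 * x)" for k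
      using x by simp
    moreover have "(\<lambda>k. ?b (Suc k) * x ^ Suc k) sums (1 / ?s - 1)"
    proof -
      have "(\<lambda>k. ?b k * x ^ k) sums (1 / ?s - 1 + ?b 0 * x ^ 0)"
        using negative_binomial_sums[of x "1 / 2"] x assms
        by (simp add: powr_minus_divide powr_half_sqrt)
      then show ?thesis
        using sums_Suc_iff[of "\<lambda>k. ?b k * x ^ k" "1 / ?s - 1"] by blast
    qed
    ultimately have "(\<lambda>k. diffs arcosh_coeff k * x ^ k) sums ((1 / ?s - 1) / (2 * x))"
      using sums_divide[of "\<lambda>k. ?b (Suc k) * x ^ Suc k" "1 / ?s - 1" "2 * x"] by simp
    moreover have "(1 / ?s - 1) / (2 * x) = 1 / (2 * ?s * (1 + ?s))"
    proof -
      have cancel: "a / (2 * x) = 1 / d" if "a * d = 2 * x" "d \<noteq> 0" for a d :: real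
        using that x by (simp add: frac_eq_eq)
      have "(1 / ?s - 1) * (2 * ?s * (1 + ?s)) = 2 * ((1 - ?s) * (1 + ?s))"
        using s(1) by (simp add: field_simps)
      also have "\<dots> = 2 * x"
        using s(2) by simp
      finally show ?thesis
        using s(1) by (intro cancel) auto
    qed
    ultimately have "(\<Sum>k. diffs arcosh_coeff k * x ^ k) = 1 / (2 * ?s * (1 + ?s))"
      by (simp add: sums_iff)
    then show "((\<lambda>z. ?F z - ?G z) has_real_derivative 0) (at x)"
      using DERIV_diff[OF dF dG] x assms by simp
  next
    show "0 \<le> z" "z \<le> z" using assms by auto
  qed
  then have "?F z = ?G z"
    using assms by (cases "z = 0") auto
  then show ?thesis
    using summable_sums[OF smb[of z]] assms by simp
qed

text \<open>The endpoint \<open>z = 1\<close> corresponds to coinciding points, so it is needed for the square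
  summability of the features. As the coefficients are nonnegative, it follows from the case
  \<open>z < 1\<close> by comparing partial sums and sums as \<open>z\<close> tends to \<open>1\<close>.\<close>

lemma arcosh_coeff_sums:
  assumes "0 \<le> z" "z \<le> 1"
  shows "(\<lambda>k. arcosh_coeff k * z ^ k) sums (ln 2 - ln (1 + sqrt (1 - z)))"
proof (cases "z = 1")
  case False
  then show ?thesis using assms by (intro arcosh_coeff_sums_lt) auto
next
  case True
  have ev: "\<forall>\<^sub>F z in at_left 1. 0 \<le> z \<and> z < (1::real)"
    using eventually_at_left_real[of 0 "1::real"] by (auto elim: eventually_mono)
  have le: "ln 2 - ln (1 + sqrt (1 - z)) \<le> ln 2" if "0 \<le> z \<and> z < 1" for z :: real
    using that by simp
  have partial: "sum arcosh_coeff {..<n} \<le> ln 2" for n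
  proof (rule tendsto_upperbound)
    have "((\<lambda>z. \<Sum>k<n. arcosh_coeff k * z ^ k) \<longlongrightarrow> (\<Sum>k<n. arcosh_coeff k * 1 ^ k)) (at_left 1)"
      by (intro tendsto_intros)
    then show "((\<lambda>z. \<Sum>k<n. arcosh_coeff k * z ^ k) \<longlongrightarrow> sum arcosh_coeff {..<n}) (at_left 1)"
      by simp
    show "\<forall>\<^sub>F z in at_left 1. (\<Sum>k<n. arcosh_coeff k * z ^ k) \<le> ln 2"
      using ev
    proof eventually_elim
      case (elim z)
      have "(\<Sum>k<n. arcosh_coeff k * z ^ k) \<le> (\<Sum>k. arcosh_coeff k * z ^ k)"
        using elim arcosh_coeff_sums_lt[of z]
        by (intro sum_le_suminf) (auto simp: sums_iff arcosh_coeff_nonneg)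
      also have "\<dots> = ln 2 - ln (1 + sqrt (1 - z))"
        using arcosh_coeff_sums_lt[of z] elim by (simp add: sums_iff)
      finally show ?case using le[OF elim] by simp
    qed
  qed simp
  have sm: "summable arcosh_coeff"
    by (rule summableI_nonneg_bounded[OF arcosh_coeff_nonneg partial])
  have "ln 2 \<le> suminf arcosh_coeff"
  proof (rule tendsto_upperbound)
    have "((\<lambda>z::real. ln 2 - ln (1 + sqrt (1 - z))) \<longlongrightarrow> ln 2 - ln (1 + sqrt (1 - 1))) (at_left 1)"
      by (intro tendsto_intros) auto
    then show "((\<lambda>z::real. ln 2 - ln (1 + sqrt (1 - z))) \<longlongrightarrow> ln 2) (at_left 1)"
      by simp
    show "\<forall>\<^sub>F z in at_left 1. ln 2 - ln (1 + sqrt (1 - z)) \<le> suminf arcosh_coeff"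
      using ev
    proof eventually_elim
      case (elim z)
      have "ln 2 - ln (1 + sqrt (1 - z)) = (\<Sum>k. arcosh_coeff k * z ^ k)"
        using arcosh_coeff_sums_lt[of z] elim by (simp add: sums_iff)
      also have "\<dots> \<le> suminf arcosh_coeff"
        using elim arcosh_coeff_sums_lt[of z] sm
        by (intro suminf_le)
          (auto simp: sums_iff arcosh_coeff_nonneg power_le_one mult_left_le)
      finally show ?case .
    qed
  qed simp
  moreover have "suminf arcosh_coeff \<le> ln 2"
    by (rule suminf_le_const[OF sm partial])
  ultimately show ?thesis
    using sm True by (simp add: sums_iff)
qed

section \<open>The hyperbolic distance as a sum of squares\<close>

definition klein :: "'n::finite hyperbolic_space \<Rightarrow> real^'n" where
  "klein p = fst (Rep_hyperbolic_space p) /\<^sub>R snd (Rep_hyperbolic_space p)"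

definition height :: "'n::finite hyperbolic_space \<Rightarrow> real" where
  "height p = snd (Rep_hyperbolic_space p)"

lemma height_pos: "0 < height p"
  using Rep_hyperbolic_space[of p] by (simp add: height_def)

lemma fst_Rep_hyperbolic_space: "fst (Rep_hyperbolic_space p) = height p *\<^sub>R klein p"
  using height_pos[of p] by (simp add: klein_def height_def)

lemma lorentz_klein:
  "- lorentz (Rep_hyperbolic_space p) (Rep_hyperbolic_space q)
    = height p * height q * (1 - klein p \<bullet> klein q)"
  by (simp add: lorentz_def fst_Rep_hyperbolic_space algebra_simps flip: height_def)

lemma height_square_klein: "(height p)\<^sup>2 * (1 - klein p \<bullet> klein p) = 1"
  using lorentz_klein[of p p] Rep_hyperbolic_space[of p] by (simp add: power2_eq_square)

lemma norm_klein_less_1: "norm (klein p) < 1"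
proof -
  have "0 < (height p)\<^sup>2 * (1 - klein p \<bullet> klein p)"
    by (simp add: height_square_klein)
  then have "klein p \<bullet> klein p < 1\<^sup>2"
    by (simp add: zero_less_mult_iff)
  then show ?thesis
    by (simp only: dot_square_norm power2_less_imp_less zero_le_one)
qed

lemma abs_inner_klein_less_1: "\<bar>klein p \<bullet> klein q\<bar> < 1"
proof -
  have "\<bar>klein p \<bullet> klein q\<bar> \<le> norm (klein p) * norm (klein q)"
    by (rule Cauchy_Schwarz_ineq2)
  also have "\<dots> \<le> norm (klein p) * 1"
    using norm_klein_less_1[of q] by (intro mult_left_mono) auto
  finally show ?thesis
    using norm_klein_less_1[of p] by simp
qed

definition cosh_dist :: "'n::finite hyperbolic_space \<Rightarrow> 'n hyperbolic_space \<Rightarrow> real" where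
  "cosh_dist p q = height p * height q * (1 - klein p \<bullet> klein q)"

lemma dist_eq_arcosh: "dist p q = arcosh (cosh_dist p q)"
  by (simp add: dist_hyperbolic_space_def lorentz_klein cosh_dist_def)

lemma cosh_dist_ge_1: "1 \<le> cosh_dist p q"
proof -
  have "lorentz (Rep_hyperbolic_space p) (Rep_hyperbolic_space q) \<le> - 1"
    using Rep_hyperbolic_space[of p] Rep_hyperbolic_space[of q] by (intro lorentz_hyperboloid) auto
  then show ?thesis
    using lorentz_klein[of p q] by (simp add: cosh_dist_def)
qed

lemma cosh_dist_self: "cosh_dist p p = 1"
  using height_square_klein[of p] by (simp add: cosh_dist_def power2_eq_square)

text \<open>A positive definite kernel that equals minus the distance up to terms depending on one point
  only (\<open>kernel_eq\<close>). It is written as a sum of two functions with nonnegative power series, in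
  \<open>klein p \<bullet> klein q\<close> and in \<open>1 / (cosh_dist p q)\<^sup>2\<close>.\<close>

definition kernel :: "'n::finite hyperbolic_space \<Rightarrow> 'n hyperbolic_space \<Rightarrow> real" where
  "kernel p q = - ln (1 - klein p \<bullet> klein q) + (ln 2 - ln (1 + sqrt (1 - 1 / (cosh_dist p q)\<^sup>2)))"

text \<open>This is \<open>arcosh u = ln u + ln (1 + sqrt (1 - 1 / u\<^sup>2))\<close>, with the factors of
  \<open>u = height p * height q * (1 - klein p \<bullet> klein q)\<close> separated by the logarithm.\<close>

lemma kernel_eq: "kernel p q = ln (height p) + ln (height q) + ln 2 - dist p q"
proof -
  let ?u = "cosh_dist p q"
  have u: "1 \<le> ?u" by (rule cosh_dist_ge_1)
  have "?u + sqrt (?u\<^sup>2 - 1) = ?u * (1 + sqrt (1 - 1 / ?u\<^sup>2))"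
  proof -
    have "?u\<^sup>2 - 1 = ?u\<^sup>2 * (1 - 1 / ?u\<^sup>2)"
      using u by (simp add: field_simps)
    then show ?thesis
      using u by (simp add: real_sqrt_mult distrib_left)
  qed
  moreover have "0 < 1 + sqrt (1 - 1 / ?u\<^sup>2)"
    using u by (intro add_pos_nonneg) auto
  ultimately have "dist p q = ln ?u + ln (1 + sqrt (1 - 1 / ?u\<^sup>2))"
    using u by (simp add: dist_eq_arcosh arcosh_real_def ln_mult)
  moreover have "ln ?u = ln (height p) + ln (height q) + ln (1 - klein p \<bullet> klein q)"
    using height_pos[of p] height_pos[of q] abs_inner_klein_less_1[of p q]
    by (simp add: cosh_dist_def ln_mult)
  ultimately show ?thesis
    by (simp add: kernel_def)
qed

lemma dist_eq_kernel: "2 * dist p q = kernel p p + kernel q q - 2 * kernel p q"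
  by (simp add: kernel_eq)

definition monomial :: "'n list \<Rightarrow> real^'n::finite \<Rightarrow> real" where
  "monomial l x = (\<Prod>i\<leftarrow>l. x $ i)"

lemma monomial_simps [simp]:
  "monomial [] x = 1" "monomial (i # l) x = x $ i * monomial l x"
  by (simp_all add: monomial_def)

lemma monomial_append: "monomial (l @ m) x = monomial l x * monomial m x"
  by (simp add: monomial_def)

lemma inner_power_eq_sum_monomial:
  "(x \<bullet> y) ^ j = (\<Sum>l | length l = j. monomial l x * monomial l (y :: real^'n::finite))"
proof (induction j)
  case (Suc j)
  have "(x \<bullet> y) ^ Suc j = (\<Sum>i\<in>UNIV. \<Sum>l | length l = j. monomial (i # l) x * monomial (i # l) y)"
    unfolding power_Suc Suc unfolding inner_vec_def[of x y] sum_product by (simp add: ac_simps)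
  also have "\<dots> = (\<Sum>(i, l)\<in>UNIV \<times> {l. length l = j}. monomial (i # l) x * monomial (i # l) y)"
    by (rule sum.cartesian_product)
  also have "\<dots> = (\<Sum>l | length l = Suc j. monomial l x * monomial l y)"
    by (rule sum.reindex_bij_witness[where i = "\<lambda>l. (hd l, tl l)" and j = "\<lambda>(i, l). i # l"])
      (auto simp: length_Suc_conv)
  finally show ?case .
qed simp

text \<open>Coefficients of \<open>(klein p \<bullet> klein q) ^ j\<close> in the expansion of the \<open>k\<close>-th kernel term below. For
  \<open>k = 0\<close> this is the series of \<open>- ln (1 - w)\<close>, with the default value \<open>1 / 0 = 0\<close> for the missing
  constant term; for \<open>k > 0\<close> it is
  \<open>arcosh_coeff k\<close> times the binomial series of \<open>(1 - w) powr - (2 * k)\<close>. The powers of the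
  heights are kept apart, as each belongs to one of the two points.\<close>

definition feature_coeff :: "nat \<Rightarrow> nat \<Rightarrow> real" where
  "feature_coeff k j = (if k = 0 then 1 / real j else arcosh_coeff k * (pochhammer (2 * real k) j / fact j))"

lemma feature_coeff_nonneg: "0 \<le> feature_coeff k j"
  by (simp add: feature_coeff_def arcosh_coeff_nonneg pochhammer_nonneg)

definition feature :: "nat \<times> nat \<times> 'n list \<Rightarrow> 'n::finite hyperbolic_space \<Rightarrow> real" where
  "feature = (\<lambda>(k, j, l) p. sqrt (feature_coeff k j) * (1 / height p) ^ (2 * k) * monomial l (klein p))"

definition feature_index :: "(nat \<times> nat \<times> 'n::finite list) set" where
  "feature_index = (SIGMA k:UNIV. SIGMA j:UNIV. {l. length l = j})"

text \<open>Once absolute convergence of the double family is known, iterated series may be summed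
  conditionally; the value is then the right one by uniqueness.\<close>

lemma has_sum_Sigma_nat:
  fixes f :: "nat \<times> 'b \<Rightarrow> real"
  assumes f: "\<And>n. ((\<lambda>y. f (n, y)) has_sum g n) (B n)" and g: "g sums s"
    and summable: "f summable_on Sigma UNIV B"
  shows "(f has_sum s) (Sigma UNIV B)"
proof -
  have *: "(f has_sum infsum f (Sigma UNIV B)) (Sigma UNIV B)"
    using summable by simp
  then have "(g has_sum infsum f (Sigma UNIV B)) UNIV"
    using f by (rule has_sum_SigmaD)
  then have "g sums infsum f (Sigma UNIV B)"
    by (rule has_sum_imp_sums)
  then show ?thesis
    using * sums_unique2[OF g] by simp
qed

lemma has_sum_Sigma_nat_nonneg:
  fixes f :: "nat \<times> 'b \<Rightarrow> real"
  assumes f: "\<And>n. ((\<lambda>y. f (n, y)) has_sum g n) (B n)" and g: "g sums s"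
    and nonneg: "\<And>n y. y \<in> B n \<Longrightarrow> 0 \<le> f (n, y)"
  shows "(f has_sum s) (Sigma UNIV B)"
proof (rule has_sum_Sigma_nat[OF f g])
  have "0 \<le> g n" for n
    using has_sum_nonneg[OF f] nonneg by blast
  then have "g summable_on UNIV"
    using sums_nonneg_imp_has_sum[OF g] by (auto simp: summable_on_def)
  then show "f summable_on Sigma UNIV B"
    using f nonneg by (intro summable_on_SigmaI) auto
qed

text \<open>Reduces convergence off the diagonal, where terms have both signs, to the diagonal, where
  they are squares.\<close>

lemma summable_on_mult_if_squares:
  fixes f g :: "'t \<Rightarrow> real"
  assumes "(\<lambda>t. f t * f t) summable_on T" "(\<lambda>t. g t * g t) summable_on T"
  shows "(\<lambda>t. f t * g t) summable_on T"
proof -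
  have "(\<lambda>t. f t * f t + g t * g t) summable_on T"
    by (intro summable_on_add assms)
  then have "(\<lambda>t. norm (f t * g t)) summable_on T"
  proof (rule summable_on_comparison_test)
    show "norm (f t * g t) \<le> f t * f t + g t * g t" for t
    proof -
      have "2 * \<bar>f t\<bar> * \<bar>g t\<bar> \<le> f t * f t + g t * g t"
        using sum_squares_bound[of "\<bar>f t\<bar>" "\<bar>g t\<bar>"] by (simp add: power2_eq_square)
      moreover have "0 \<le> \<bar>f t\<bar> * \<bar>g t\<bar>"
        by simp
      ultimately show ?thesis
        unfolding real_norm_def abs_mult by linarith
    qed
  qed simp
  then show ?thesis
    using summable_on_iff_abs_summable_on_real by blast
qed

text \<open>The two halves of \<^const>\<open>kernel\<close> share one index: \<open>k = 0\<close> carries the logarithm, a slot left free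
  by \<open>arcosh_coeff 0 = 0\<close>.\<close>

definition kernel_term :: "nat \<Rightarrow> 'n::finite hyperbolic_space \<Rightarrow> 'n hyperbolic_space \<Rightarrow> real" where
  "kernel_term k p q = (if k = 0 then - ln (1 - klein p \<bullet> klein q)
    else arcosh_coeff k * (1 / (cosh_dist p q)\<^sup>2) ^ k)"

lemma kernel_term_sums: "(\<lambda>k. kernel_term k p q) sums kernel p q"
proof -
  let ?L = "- ln (1 - klein p \<bullet> klein q)" and ?z = "1 / (cosh_dist p q)\<^sup>2"
  have "(\<lambda>k. (if k = 0 then ?L else 0) + arcosh_coeff k * ?z ^ k) sums kernel p q"
    unfolding kernel_def
  proof (intro sums_add arcosh_coeff_sums)
    show "(\<lambda>k. if k = 0 then ?L else 0) sums ?L"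
      using sums_single[of 0 "\<lambda>_. ?L"] by simp
  qed (use cosh_dist_ge_1[of p q] in auto)
  moreover have "(if k = 0 then ?L else 0) + arcosh_coeff k * ?z ^ k = kernel_term k p q" for k
    by (simp add: kernel_term_def)
  ultimately show ?thesis by simp
qed

lemma kernel_term_expansion_sums:
  "(\<lambda>j. feature_coeff k j * (1 / (height p * height q)) ^ (2 * k) * (klein p \<bullet> klein q) ^ j)
    sums kernel_term k p q"
proof (cases "k = 0")
  case True
  let ?w = "klein p \<bullet> klein q"
  have "(\<lambda>j. - (- (?w ^ j / real j))) sums - ln (1 - ?w)"
    using sums_minus[OF ln_series'[of "- ?w"]] abs_inner_klein_less_1[of p q] by simp
  then show ?thesis
    by (simp add: True feature_coeff_def kernel_term_def)
next
  case False
  let ?w = "klein p \<bullet> klein q"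
  define r where "r = arcosh_coeff k * (1 / (height p * height q)) ^ (2 * k)"
  have w: "0 < 1 - ?w" "\<bar>?w\<bar> < 1"
    using abs_inner_klein_less_1[of p q] by auto
  have "(\<lambda>j. r * (pochhammer (2 * real k) j / fact j * ?w ^ j)) sums (r * (1 - ?w) powr - (2 * real k))"
    by (intro sums_mult negative_binomial_sums w)
  moreover have "r * (1 - ?w) powr - (2 * real k) = kernel_term k p q"
  proof -
    have "(1 - ?w) powr - (2 * real k) = 1 / (1 - ?w) ^ (2 * k)"
      using w powr_realpow[of "1 - ?w" "2 * k"] by (simp add: powr_minus_divide)
    then show ?thesis
      using False by (simp add: kernel_term_def r_def cosh_dist_def power_divide power_mult_distrib
          flip: power_mult)
  qed
  ultimately show ?thesis
    using False by (simp add: feature_coeff_def r_def mult_ac)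
qed

lemma feature_product:
  "feature (k, j, l) p * feature (k, j, l) q
    = feature_coeff k j * (1 / (height p * height q)) ^ (2 * k) * (monomial l (klein p) * monomial l (klein q))"
proof -
  have "feature (k, j, l) p * feature (k, j, l) q = (sqrt (feature_coeff k j) * sqrt (feature_coeff k j))
      * ((1 / height p) ^ (2 * k) * (1 / height q) ^ (2 * k)) * (monomial l (klein p) * monomial l (klein q))"
    by (simp add: feature_def)
  then show ?thesis
    by (simp add: feature_coeff_nonneg power_divide power_mult_distrib)
qed

lemma has_sum_feature_monomials:
  "((\<lambda>l. feature (k, j, l) p * feature (k, j, l) q) has_sum
    feature_coeff k j * (1 / (height p * height q)) ^ (2 * k) * (klein p \<bullet> klein q) ^ j) {l. length l = j}"
  unfolding feature_product inner_power_eq_sum_monomial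
  by (intro has_sum_cmult_right has_sum_finite)
    (use finite_lists_length_eq[OF finite_class.finite_UNIV] in simp)

text \<open>The double series in \<open>k\<close> and \<open>j\<close> is summed first for \<open>p = q\<close>, where all terms are nonnegative;
  this yields the absolute convergence needed for arbitrary \<open>p\<close> and \<open>q\<close>.\<close>

lemma has_sum_feature_kernel:
  "((\<lambda>t. feature t p * feature t q) has_sum kernel p q) feature_index"
proof -
  let ?D = "SIGMA j:UNIV. {l :: 'a list. length l = j}"
  have diag1: "((\<lambda>(j, l). feature (k, j, l) p * feature (k, j, l) p) has_sum kernel_term k p p) ?D"
    for k and p :: "'a hyperbolic_space"
    by (rule has_sum_Sigma_nat_nonneg[OF _ kernel_term_expansion_sums])
      (use has_sum_feature_monomials in auto)
  have diag: "((\<lambda>t. feature t p * feature t p) has_sum kernel p p) feature_index"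
    for p :: "'a hyperbolic_space"
    unfolding feature_index_def
    by (rule has_sum_Sigma_nat_nonneg[OF _ kernel_term_sums])
      (use diag1 in \<open>auto simp: case_prod_unfold\<close>)
  have off1: "((\<lambda>(j, l). feature (k, j, l) p * feature (k, j, l) q) has_sum kernel_term k p q) ?D" for k
  proof (rule has_sum_Sigma_nat[OF _ kernel_term_expansion_sums])
    show "(\<lambda>(j, l). feature (k, j, l) p * feature (k, j, l) q) summable_on ?D"
      using summable_on_mult_if_squares[of "\<lambda>(j, l). feature (k, j, l) p" ?D "\<lambda>(j, l). feature (k, j, l) q"]
        diag1[of k p] diag1[of k q] by (auto simp: case_prod_unfold summable_on_def)
  qed (use has_sum_feature_monomials in auto)
  show ?thesis
    unfolding feature_index_def
  proof (rule has_sum_Sigma_nat[OF _ kernel_term_sums])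
    show "((\<lambda>t. feature (k, t) p * feature (k, t) q) has_sum kernel_term k p q) ?D" for k
      using off1 by (simp add: case_prod_unfold)
    show "(\<lambda>t. feature t p * feature t q) summable_on (SIGMA k:UNIV. ?D)"
      unfolding feature_index_def[symmetric]
      by (rule summable_on_mult_if_squares[OF has_sum_imp_summable[OF diag] has_sum_imp_summable[OF diag]])
  qed
qed

lemma has_sum_feature_dist:
  "((\<lambda>t. (feature t p - feature t q)\<^sup>2) has_sum 2 * dist p q) feature_index"
proof -
  have "((\<lambda>t. feature t p * feature t p + feature t q * feature t q - 2 * (feature t p * feature t q))
      has_sum (kernel p p + kernel q q - 2 * kernel p q)) feature_index"
    by (intro has_sum_minus has_sum_add has_sum_cmult_right has_sum_feature_kernel)
  then show ?thesis
    by (simp add: dist_eq_kernel power2_eq_square algebra_simps)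
qed

section \<open>Moments determine a measure on a compact set\<close>

lemma measure_eqI_open:
  fixes M N :: "'a::topological_space measure"
  assumes "prob_space M" "sets M = sets borel" "sets N = sets borel"
    and eq: "\<And>U. open U \<Longrightarrow> emeasure M U = emeasure N U"
  shows "M = N"
proof (rule measure_eqI_generator_eq[where E = "{U. open U}" and \<Omega> = UNIV and A = "\<lambda>_. UNIV"])
  show "Int_stable {U :: 'a set. open U}"
    by (auto simp: Int_stable_def)
  show "sets M = sigma_sets UNIV {U. open U}" "sets N = sigma_sets UNIV {U. open U}"
    using assms by (simp_all add: borel_def)
  show "emeasure M UNIV \<noteq> \<infinity>" for i :: nat
    using assms(1) by (metis finite_measure.emeasure_finite infinity_ennreal_def prob_space_def)
qed (auto intro: eq)

text \<open>Polynomials are generated as linear combinations of monomials and not by closure under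
  products, because equality of integrals is inherited by linear combinations only.\<close>

inductive monomial_span :: "(real^'n::finite \<Rightarrow> real) \<Rightarrow> bool" where
  monomial: "monomial_span (monomial l)"
| scale: "monomial_span f \<Longrightarrow> monomial_span (\<lambda>x. c * f x)"
| add: "monomial_span f \<Longrightarrow> monomial_span g \<Longrightarrow> monomial_span (\<lambda>x. f x + g x)"

lemma continuous_on_monomial: "continuous_on S (monomial l)"
  by (induction l) (auto intro!: continuous_intros simp: monomial_def)

lemma continuous_on_monomial_span: "monomial_span f \<Longrightarrow> continuous_on S f"
  by (induction rule: monomial_span.induct) (auto intro!: continuous_intros continuous_on_monomial)

lemma monomial_span_mult:
  assumes "monomial_span f" "monomial_span g"
  shows "monomial_span (\<lambda>x. f x * g x)"
proof -
  have mono: "monomial_span (\<lambda>x. monomial l x * g x)" for l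
    using assms(2)
  proof induction
    case (monomial m)
    then show ?case
      using monomial_span.monomial[of "l @ m"] by (simp add: monomial_append[abs_def])
  next
    case (scale g c)
    then show ?case
      using monomial_span.scale[of "\<lambda>x. monomial l x * g x" c] by (simp add: mult.left_commute)
  next
    case (add g h)
    then show ?case
      using monomial_span.add by (fastforce simp: distrib_left)
  qed
  show ?thesis
    using assms(1)
  proof induction
    case (monomial l)
    then show ?case by (rule mono)
  next
    case (scale f c)
    then show ?case
      using monomial_span.scale[of "\<lambda>x. f x * g x" c] by (simp add: mult.assoc)
  next
    case (add f h)
    then show ?case
      using monomial_span.add by (fastforce simp: distrib_right)
  qed
qed

lemma monomial_span_dense:
  fixes g :: "real^'n::finite \<Rightarrow> real"
  assumes "compact S" "continuous_on S g" "0 < e"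
  shows "\<exists>f. monomial_span f \<and> (\<forall>x\<in>S. \<bar>g x - f x\<bar> < e)"
proof (rule Stone_Weierstrass_HOL[OF assms(1) _ _ _ _ _ assms(2,3)])
  show "monomial_span (\<lambda>x :: real^'n. c)" for c
    using monomial_span.scale[OF monomial_span.monomial[of "[]"], of c] by simp
  show "\<exists>f. monomial_span f \<and> f x \<noteq> f y" if ne: "x \<in> S \<and> y \<in> S \<and> x \<noteq> y" for x y :: "real^'n"
  proof -
    obtain i where "x $ i \<noteq> y $ i"
      using ne by (auto simp: vec_eq_iff)
    then show ?thesis
      by (intro exI[of _ "monomial [i]"]) (auto intro: monomial_span.monomial)
  qed
qed (auto intro: continuous_on_monomial_span monomial_span.add monomial_span_mult)

lemma integrable_continuous_on_compact:
  fixes g :: "'a::euclidean_space \<Rightarrow> real"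
  assumes M: "finite_measure M" "sets M = sets borel" and S: "compact S" "AE x in M. x \<in> S"
    and g: "continuous_on UNIV g"
  shows "integrable M g"
proof -
  interpret finite_measure M by fact
  obtain B where B: "\<And>x. x \<in> S \<Longrightarrow> norm (g x) \<le> B"
    using compact_imp_bounded[OF compact_continuous_image[OF continuous_on_subset[OF g] S(1)]]
    by (auto simp: bounded_iff)
  show ?thesis
  proof (rule integrable_const_bound)
    show "AE x in M. norm (g x) \<le> B"
      using S(2) by eventually_elim (rule B)
    show "g \<in> borel_measurable M"
      using borel_measurable_continuous_onI[OF g] by (simp add: measurable_cong_sets[OF M(2) refl])
  qed
qed

text \<open>Equal moments give equal integrals of polynomials, hence of continuous functions by uniform
  approximation on \<open>S\<close>, hence equal measures of open sets by monotone approximation of their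
  indicators.\<close>

theorem measure_eqI_moments:
  fixes M N :: "(real^'n::finite) measure"
  assumes M: "prob_space M" "sets M = sets borel" "AE x in M. x \<in> S"
    and N: "prob_space N" "sets N = sets borel" "AE x in N. x \<in> S"
    and S: "compact S"
    and moments: "\<And>l. (\<integral>x. monomial l x \<partial>M) = (\<integral>x. monomial l x \<partial>N)"
  shows "M = N"
proof (rule measure_eqI_open[OF M(1,2) N(2)])
  interpret M: prob_space M by fact
  interpret N: prob_space N by fact
  note intM = integrable_continuous_on_compact[OF M.finite_measure_axioms M(2) S M(3)]
  note intN = integrable_continuous_on_compact[OF N.finite_measure_axioms N(2) S N(3)]
  have span: "(\<integral>x. f x \<partial>M) = (\<integral>x. f x \<partial>N)" if "monomial_span f" for f
    using that
  proof induction
    case (add f g)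
    then show ?case
      by (simp add: intM intN continuous_on_monomial_span)
  qed (auto simp: moments)
  have cont: "(\<integral>x. g x \<partial>M) = (\<integral>x. g x \<partial>N)" if g: "continuous_on UNIV g"
    for g :: "real^'n \<Rightarrow> real"
  proof -
    have "\<bar>(\<integral>x. g x \<partial>M) - (\<integral>x. g x \<partial>N)\<bar> \<le> e" if "0 < e" for e
    proof -
      obtain f where f: "monomial_span f" and close: "\<And>x. x \<in> S \<Longrightarrow> \<bar>g x - f x\<bar> < e / 2"
        using monomial_span_dense[OF S continuous_on_subset[OF g], of "e / 2"] \<open>0 < e\<close> by auto
      have approx: "\<bar>(\<integral>x. g x \<partial>P) - (\<integral>x. f x \<partial>P)\<bar> \<le> e / 2"
        if P: "prob_space P" "sets P = sets borel" "AE x in P. x \<in> S" for P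
      proof -
        interpret P: prob_space P by fact
        note intP = integrable_continuous_on_compact[OF P.finite_measure_axioms P(2) S P(3)]
        note int = intP[OF g] intP[OF continuous_on_monomial_span[OF f]]
        have "\<bar>\<integral>x. g x - f x \<partial>P\<bar> \<le> (\<integral>x. \<bar>g x - f x\<bar> \<partial>P)"
          by (rule integral_abs_bound)
        also have "\<dots> \<le> (\<integral>x. e / 2 \<partial>P)"
        proof (rule integral_mono_AE)
          show "AE x in P. \<bar>g x - f x\<bar> \<le> e / 2"
            using P(3)
          proof eventually_elim
            case (elim x)
            then show ?case
              using close[of x] by simp
          qed
        qed (use int in simp_all)
        finally show ?thesis
          using int by (simp add: P.prob_space)
      qed
      show ?thesis
        using approx[OF M] approx[OF N] span[OF f] by linarith
    qed
    then show ?thesis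
      using field_le_epsilon[of "\<bar>(\<integral>x. g x \<partial>M) - (\<integral>x. g x \<partial>N)\<bar>" 0] by simp
  qed
  fix V :: "(real^'n) set"
  assume V: "open V"
  show "emeasure M V = emeasure N V"
  proof (cases "V = UNIV")
    case True
    then show ?thesis
      using M.emeasure_space_1 N.emeasure_space_1 sets_eq_imp_space_eq[OF M(2)]
        sets_eq_imp_space_eq[OF N(2)] by simp
  next
    case False
    \<comment> \<open>Continuous functions increasing to the indicator of \<open>V\<close>; the complement must be nonempty here because the distance to the empty set is \<open>0\<close> by convention.\<close>
    define g where "g k x = min 1 (real k * infdist x (- V))" for k x
    have g_cont: "continuous_on UNIV (g k)" for k
      unfolding g_def by (intro continuous_intros)
    have g_lim: "(\<lambda>k. g k x) \<longlonglongrightarrow> indicator V x" for x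
    proof (cases "x \<in> V")
      case True
      then have pos: "0 < infdist x (- V)"
        using in_closed_iff_infdist_zero[of "- V" x] V False infdist_nonneg[of x "- V"]
        by (auto simp: less_le)
      then obtain k0 :: nat where k0: "1 < real k0 * infdist x (- V)"
        using reals_Archimedean3 by blast
      have "\<forall>\<^sub>F k in sequentially. g k x = 1"
        using eventually_ge_at_top[of k0]
      proof eventually_elim
        case (elim k)
        have "real k0 * infdist x (- V) \<le> real k * infdist x (- V)"
          using elim pos by (intro mult_right_mono) auto
        then show ?case
          using k0 by (simp add: g_def)
      qed
      then show ?thesis
        using True by (simp add: tendsto_eventually)
    qed (simp add: g_def)
    have lim: "(\<lambda>k. \<integral>x. g k x \<partial>P) \<longlonglongrightarrow> measure P V"
      if P: "prob_space P" "sets P = sets borel" for P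
    proof -
      interpret P: prob_space P by fact
      have "(\<lambda>k. \<integral>x. g k x \<partial>P) \<longlonglongrightarrow> (\<integral>x. indicator V x \<partial>P)"
      proof (rule integral_dominated_convergence[where w = "\<lambda>_. 1"])
        show "g k \<in> borel_measurable P" for k
          using borel_measurable_continuous_onI[OF g_cont]
          by (simp add: measurable_cong_sets[OF P(2) refl])
        show "(\<lambda>x. indicator V x :: real) \<in> borel_measurable P"
          using V P(2) by (intro borel_measurable_indicator) auto
        show "AE x in P. norm (g k x) \<le> 1" for k
          by (simp add: g_def infdist_nonneg)
      qed (use g_lim in auto)
      then show ?thesis
        using V P(2) by simp
    qed
    have "measure M V = measure N V"
      using LIMSEQ_unique[OF lim[OF M(1,2)]] lim[OF N(1,2)] by (simp add: cont[OF g_cont])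
    then show ?thesis
      by (simp add: M.emeasure_eq_measure N.emeasure_eq_measure)
  qed
qed

section \<open>Measures on hyperbolic space with equal feature means\<close>

lemma height_eq_klein: "height p = 1 / sqrt (1 - klein p \<bullet> klein p)"
proof -
  have "sqrt ((height p)\<^sup>2 * (1 - klein p \<bullet> klein p)) = 1"
    by (simp add: height_square_klein)
  then have "height p * sqrt (1 - klein p \<bullet> klein p) = 1"
    using height_pos[of p] by (simp add: real_sqrt_mult)
  then show ?thesis
    by (auto simp: eq_divide_eq)
qed

text \<open>By the formula for \<^const>\<open>height\<close>, the hyperbolic cosine of the distance from \<open>p\<close> is a continuous
  function of the Klein coordinates, with value \<open>1\<close> at \<open>p\<close>.\<close>

lemma dist_less_if_klein_close:
  assumes "0 < e"
  shows "\<exists>d>0. \<forall>q. dist (klein q) (klein p) < d \<longrightarrow> dist p q < e"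
proof -
  let ?X = "klein p"
  define h where "h Y = (1 - ?X \<bullet> Y) / (sqrt (1 - ?X \<bullet> ?X) * sqrt (1 - Y \<bullet> Y))" for Y
  have h: "cosh_dist p q = h (klein q)" for q
    by (simp add: cosh_dist_def height_eq_klein[of p] height_eq_klein[of q] h_def)
  have "?X \<bullet> ?X < 1"
    using abs_inner_klein_less_1[of p p] by simp
  then have "isCont h ?X"
    unfolding h_def by (intro continuous_intros) auto
  moreover have "h ?X < cosh e"
    using cosh_dist_self[of p] assms cosh_real_strict_mono[of 0 e] by (simp add: h)
  ultimately have "\<forall>\<^sub>F Y in at ?X. h Y < cosh e"
    unfolding isCont_def by (rule order_tendstoD(2))
  then obtain d where d: "0 < d" "\<And>Y. Y \<noteq> ?X \<Longrightarrow> dist Y ?X < d \<Longrightarrow> h Y < cosh e"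
    by (auto simp: eventually_at)
  have "dist p q < e" if "dist (klein q) ?X < d" for q
  proof -
    have "cosh_dist p q < cosh e"
      using d(2)[of "klein q"] that \<open>h ?X < cosh e\<close> by (cases "klein q = ?X") (auto simp: h)
    then have "arcosh (cosh_dist p q) < arcosh (cosh e)"
      using cosh_dist_ge_1 by (intro arcosh_real_strict_mono)
    then show ?thesis
      using assms by (simp add: dist_eq_arcosh arcosh_cosh_real)
  qed
  then show ?thesis
    using d(1) by blast
qed

text \<open>Hence \<^const>\<open>klein\<close> is injective with continuous inverse on its range, so that a Borel probability
  measure on hyperbolic space is determined by its image under \<^const>\<open>klein\<close>.\<close>

lemma open_eq_vimage_klein:
  fixes U :: "'n::finite hyperbolic_space set"
  assumes "open U"
  obtains V where "open V" "U = klein -` V"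
proof
  define V where "V = (\<Union>p\<in>U. \<Union>d\<in>{d. \<forall>q. dist (klein q) (klein p) < d \<longrightarrow> q \<in> U}. ball (klein p) d)"
  show "open V"
    by (auto simp: V_def)
  have "p \<in> klein -` V" if p: "p \<in> U" for p
  proof -
    obtain e where "0 < e" and e: "\<And>q. dist p q < e \<Longrightarrow> q \<in> U"
      using assms p by (auto simp: open_contains_ball subset_iff)
    then obtain d where "0 < d" "\<And>q. dist (klein q) (klein p) < d \<Longrightarrow> q \<in> U"
      using dist_less_if_klein_close[of e p] by blast
    then show ?thesis
      using p by (force simp: V_def)
  qed
  moreover have "q \<in> U" if "q \<in> klein -` V" for q
    using that by (auto simp: V_def dist_commute)
  ultimately show "U = klein -` V"
    by blast
qed

lemma monomial_klein_eq_feature: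
  "monomial l (klein p) = sqrt (real (length l)) * feature (0, length l, l) p" if "l \<noteq> []"
  using that by (simp add: feature_def feature_coeff_def real_sqrt_divide)

text \<open>The features with \<open>k = 0\<close> are, up to positive factors, all nonconstant monomials in the Klein
  coordinates, and the constant monomial has mean \<open>1\<close>. So the images of the two measures in the
  closed unit ball have the same moments. The coordinates themselves are among these features and
  therefore measurable.\<close>

lemma P1_eq_if_feature_means_eq:
  fixes \<mu> \<nu> :: "'n::finite hyperbolic_space measure"
  assumes \<mu>: "\<mu> \<in> P1" and \<nu>: "\<nu> \<in> P1"
    and means: "\<And>t. t \<in> feature_index \<Longrightarrow> (\<integral>p. feature t p \<partial>\<mu>) = (\<integral>p. feature t p \<partial>\<nu>)"
  shows "\<mu> = \<nu>"
proof -
  have index: "(0, length l, l) \<in> feature_index" for l :: "'n list"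
    by (simp add: feature_index_def)
  have meas: "klein \<in> borel_measurable \<rho>" if \<rho>: "\<rho> \<in> P1" for \<rho> :: "'n hyperbolic_space measure"
    unfolding borel_measurable_euclidean_space[of klein]
  proof
    fix b :: "real^'n"
    assume "b \<in> Basis"
    then obtain i where b: "b = axis i 1"
      by (auto simp: Basis_vec_def)
    have "integrable \<rho> (feature (0, length [i], [i]))"
      by (rule integrable_feature(1)[OF _ has_sum_feature_dist index \<rho>]) simp
    then have "feature (0, length [i], [i]) \<in> borel_measurable \<rho>"
      by simp
    moreover have "klein p \<bullet> b = feature (0, length [i], [i]) p" for p
      using monomial_klein_eq_feature[of "[i]" p] by (simp add: b inner_axis)
    ultimately show "(\<lambda>p. klein p \<bullet> b) \<in> borel_measurable \<rho>"
      by simp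
  qed
  have distr: "distr \<mu> borel klein = distr \<nu> borel klein"
  proof (rule measure_eqI_moments[where S = "cball 0 1"])
    show "prob_space (distr \<mu> borel klein)" "prob_space (distr \<nu> borel klein)"
      using \<mu> \<nu> meas by (auto simp: P1_def intro!: prob_space.prob_space_distr)
    have klein_in: "klein p \<in> cball 0 1" for p :: "'n hyperbolic_space"
      using norm_klein_less_1[of p] by simp
    show "AE x in distr \<mu> borel klein. x \<in> cball 0 1" "AE x in distr \<nu> borel klein. x \<in> cball 0 1"
      using klein_in by (auto simp: AE_distr_iff meas \<mu> \<nu>)
    show "(\<integral>x. monomial l x \<partial>distr \<mu> borel klein) = (\<integral>x. monomial l x \<partial>distr \<nu> borel klein)" for l
    proof -
      have "(\<integral>p. monomial l (klein p) \<partial>\<mu>) = (\<integral>p. monomial l (klein p) \<partial>\<nu>)"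
      proof (cases "l = []")
        case True
        then show ?thesis
          using \<mu> \<nu> by (simp add: P1_def prob_space.prob_space)
      next
        case False
        then show ?thesis
          by (simp add: monomial_klein_eq_feature means[OF index])
      qed
      then show ?thesis
        unfolding integral_distr[OF meas[OF \<mu>] borel_measurable_continuous_onI[OF continuous_on_monomial]]
          integral_distr[OF meas[OF \<nu>] borel_measurable_continuous_onI[OF continuous_on_monomial]] .
    qed
  qed auto
  show ?thesis
  proof (rule measure_eqI_open)
    show "prob_space \<mu>" "sets \<mu> = sets borel" "sets \<nu> = sets borel"
      using \<mu> \<nu> by (auto simp: P1_def)
    fix U :: "'n hyperbolic_space set"
    assume "open U"
    then obtain V where V: "open V" "U = klein -` V"
      by (rule open_eq_vimage_klein)
    have "emeasure \<rho> U = emeasure (distr \<rho> borel klein) V" if "\<rho> \<in> P1" for \<rho>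
    proof -
      have "space \<rho> = UNIV"
        using that sets_eq_imp_space_eq[of \<rho> borel] by (simp add: P1_def)
      then show ?thesis
        using V meas[OF that] by (simp add: emeasure_distr)
    qed
    then show "emeasure \<mu> U = emeasure \<nu> U"
      using \<mu> \<nu> distr by simp
  qed
qed

theorem mainTheorem1: "strong_negative_type TYPE('n::finite hyperbolic_space)"
proof (rule strong_negative_type_if_sum_of_squares)
  show "countable (feature_index :: (nat \<times> nat \<times> 'n list) set)"
    by (rule countableI_type)
  show "((\<lambda>t. (feature t p - feature t q)\<^sup>2) has_sum 2 * dist p q) feature_index"
    for p q :: "'n hyperbolic_space"
    by (rule has_sum_feature_dist)
qed (auto intro: P1_eq_if_feature_means_eq)

end
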